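(* Let $D$ be a digraph that contains no subdivision of $\hat{C}_4$ as a subdigraph. If $D$ admits an out-generator, then $\chi(D)\le 24$.
   Context: Digraphs are finite, without loops or parallel arcs (two opposite arcs between the same two vertices are allowed). The chromatic number $\chi(D)$ of a digraph $D$ is the chromatic number of its underlying undirected graph. $\hat{C}_4$ is the antidirected cycle on four vertices: the orientation of the $4$-cycle in which two vertices have out-degree $2$ and the other two have in-degree $2$. A subdivision of a digraph $F$ is obtained from $F$ by replacing each arc $uv$ by a directed $(u,v)$-path of length at least $1$, these paths being pairwise internally disjoint with new internal vertices. An out-generator of $D$ is a vertex $u$ such that for every $x\in V(D)$ there is a directed $(u,x)$-path in $D$. *)

theory Defs
  imports "Graph_Theory.Graph_Theory"
begin

definition out_generator :: "('a,'b) pre_digraph \<Rightarrow> 'a \<Rightarrow> bool" where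
  "out_generator D u \<longleftrightarrow>
     u \<in> verts D \<and> (\<forall>x \<in> verts D. \<exists>p. pre_digraph.apath D u p x)"

definition k_colourable :: "('a,'b) pre_digraph \<Rightarrow> nat \<Rightarrow> bool" where
  "k_colourable G k \<longleftrightarrow>
     (\<exists>c. c \<in> verts G \<rightarrow> {..<k} \<and> (\<forall>(u,v) \<in> arcs_ends G. c u \<noteq> c v))"

text \<open>The underlying undirected graph is represented by the symmetric digraph
  \<^const>\<open>mk_symmetric\<close>. The minimum ranges over a nonempty set of numbers
  for every finite loopless digraph, see \<open>ex_k_colourable\<close> below.\<close>

definition chromatic_number :: "('a,'b) pre_digraph \<Rightarrow> nat" where
  "chromatic_number D = (LEAST k. k_colourable (with_proj (mk_symmetric D)) k)"

lemma ex_k_colourable: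
  assumes "digraph D"
  shows "k_colourable (with_proj (mk_symmetric D)) (card (verts D))"
proof -
  interpret digraph D by fact
  obtain c where c: "bij_betw c (verts D) {0..<card (verts D)}"
    using ex_bij_betw_finite_nat[OF finite_verts] by blast
  have "c (tail D e) \<noteq> c (head D e)" if "e \<in> arcs D" for e
    using that c no_loops by (auto simp: bij_betw_def dest: inj_onD)
  moreover have "c \<in> verts D \<rightarrow> {..<card (verts D)}"
    using c by (auto simp: bij_betw_def)
  ultimately have "c \<in> verts (with_proj (mk_symmetric D)) \<rightarrow> {..<card (verts D)} \<and>
      (\<forall>(u,v) \<in> arcs_ends (with_proj (mk_symmetric D)). c u \<noteq> c v)"
    unfolding with_proj_simps by (fastforce simp: mk_symmetric_def)
  then show ?thesis
    unfolding k_colourable_def by blast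
qed

definition hat_C4 :: "nat pair_pre_digraph" where
  "hat_C4 = \<lparr> pverts = {0,1,2,3}, parcs = {(0,1),(2,1),(2,3),(0,3)} \<rparr>"

lemma digraph_hat_C4: "digraph (with_proj hat_C4)"
proof -
  interpret pair_digraph hat_C4
    by unfold_locales (auto simp: hat_C4_def)
  show ?thesis ..
qed

text \<open>\<open>H\<close> is a subdivision of \<open>F\<close>: the map \<open>f\<close> sends the vertices of \<open>F\<close> to the branch
  vertices, and \<open>P a\<close> is the (arc list of the) path of \<open>H\<close> replacing the arc \<open>a\<close>. Since \<open>F\<close>
  has no parallel arcs, paths replacing distinct arcs of \<open>F\<close> are automatically arc-disjoint.\<close>

definition directed_subdivision :: "('c,'d) pre_digraph \<Rightarrow> ('a,'b) pre_digraph \<Rightarrow> bool" where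
  "directed_subdivision F H \<longleftrightarrow> digraph F \<and> digraph H \<and>
     (\<exists>f P. inj_on f (verts F)
        \<and> (\<forall>a \<in> arcs F. P a \<noteq> [] \<and> pre_digraph.apath H (f (tail F a)) (P a) (f (head F a)))
        \<and> (\<forall>a \<in> arcs F. set (pre_digraph.inner_verts H (P a)) \<inter> f ` verts F = {})
        \<and> (\<forall>a \<in> arcs F. \<forall>b \<in> arcs F. a \<noteq> b \<longrightarrow>
             set (pre_digraph.inner_verts H (P a)) \<inter> set (pre_digraph.inner_verts H (P b)) = {})
        \<and> verts H = f ` verts F \<union> (\<Union>a \<in> arcs F. set (pre_digraph.inner_verts H (P a)))
        \<and> arcs H = (\<Union>a \<in> arcs F. set (P a)))"

definition contains_subdivision :: "('a,'b) pre_digraph \<Rightarrow> ('c,'d) pre_digraph \<Rightarrow> bool" where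
  "contains_subdivision D F \<longleftrightarrow> (\<exists>H. subgraph H D \<and> directed_subdivision F H)"

end

theory Submission
  imports Defs
begin

text \<open>
  The proof uses a breadth-first search tree \<open>T\<close> grown from the out-generator. By the choice of
  the levels, an arc raises the level by at most one. The arcs that raise it are properly
  coloured by the parity of the level, so the work lies in the \<^emph>\<open>nondescending\<close> arcs
  \<open>x \<rightarrow> y\<close> with \<open>level y \<le> level x\<close>; these are coloured with \<open>5\<close> colours. The product
  colouring then uses \<open>10\<close> colours, within the required \<open>24\<close>.

  A subdivision of \<^const>\<open>hat_C4\<close> arises as soon as two arcs \<open>x \<rightarrow> b\<close>, \<open>x \<rightarrow> d\<close> meet two
  paths from some \<open>w\<close> to \<open>b\<close> and to \<open>d\<close> that share only \<open>w\<close> and avoid \<open>x\<close>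
  (\<open>contains_subdivision_hat_C4I\<close>). Tree paths supply such paths, because all their inner
  vertices lie on lower levels than their last vertex. This has two consequences.

  \<^item> The heads of the nondescending arcs leaving a vertex \<open>x\<close> are pairwise comparable in the
    ancestor order of \<open>T\<close>: two incomparable heads would be the ends of the tree paths from their
    lowest common ancestor \<open>w\<close>. So \<open>x\<close> has a topmost head, \<open>top x\<close>.

  \<^item> Delete the arc \<open>x \<rightarrow> top x\<close> at every \<open>x\<close>. Then at most one of the remaining nondescending
    arcs enters each vertex \<open>y\<close>. For if \<open>x \<rightarrow> y\<close> and \<open>z \<rightarrow> y\<close> both survive, \<open>top x\<close> and \<open>top z\<close> are
    ancestors of \<open>y\<close>, say \<open>top x\<close> above or equal to \<open>top z\<close>, and the paths \<open>x \<rightarrow> y\<close> and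
    \<open>x \<rightarrow> top x \<rightarrow> \<dots> \<rightarrow> top z\<close> close up with the arcs \<open>z \<rightarrow> y\<close> and \<open>z \<rightarrow> top z\<close>.

  Hence the nondescending arcs split into a part of out-degree at most one and a part of in-degree
  at most one. Every vertex set \<open>S\<close> then spans at most \<open>2 |S|\<close> of them, so it contains a vertex
  of degree at most \<open>4\<close>, and greedy colouring needs only \<open>5\<close> colours.
\<close>

section \<open>Colouring sparse relations\<close>

text \<open>A vertex of small degree can always be coloured last, so induction removes it first.\<close>

lemma greedy_colouring:
  fixes A :: "('a \<times> 'a) set"
  assumes "finite V" "irrefl A"
    and "\<And>S. S \<subseteq> V \<Longrightarrow> S \<noteq> {} \<Longrightarrow> \<exists>v\<in>S. card {w \<in> S. (v, w) \<in> A \<or> (w, v) \<in> A} < k"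
  shows "\<exists>c. c ` V \<subseteq> {..<k::nat} \<and> (\<forall>x\<in>V. \<forall>y\<in>V. (x, y) \<in> A \<longrightarrow> c x \<noteq> c y)"
  using assms(1,3)
proof (induction "card V" arbitrary: V)
  case 0
  then show ?case by auto
next
  case (Suc n)
  then have "V \<noteq> {}" by auto
  then obtain v where v: "v \<in> V" and deg: "card {w \<in> V. (v, w) \<in> A \<or> (w, v) \<in> A} < k"
    using Suc.prems(2) by blast
  define N where "N = {w \<in> V. (v, w) \<in> A \<or> (w, v) \<in> A}"
  have "n = card (V - {v})" using Suc.hyps(2) v Suc.prems(1) by simp
  then obtain c where c: "c ` (V - {v}) \<subseteq> {..<k}"
      "\<forall>x\<in>V - {v}. \<forall>y\<in>V - {v}. (x, y) \<in> A \<longrightarrow> c x \<noteq> c y"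
    using Suc.hyps(1)[of "V - {v}"] Suc.prems by (auto simp: subset_Diff_insert)
  have "finite N" using Suc.prems(1) by (simp add: N_def)
  then have "card (c ` N) < card {..<k}"
    using card_image_le[of N c] deg by (simp add: N_def)
  then have "\<not> {..<k} \<subseteq> c ` N"
    using card_mono[of "c ` N" "{..<k}"] \<open>finite N\<close> by auto
  then obtain i where i: "i < k" "i \<notin> c ` N" by auto
  have "(v, v) \<notin> A" using \<open>irrefl A\<close> by (auto simp: irrefl_def)
  then have "(c(v := i)) ` V \<subseteq> {..<k}"
    "\<forall>x\<in>V. \<forall>y\<in>V. (x, y) \<in> A \<longrightarrow> (c(v := i)) x \<noteq> (c(v := i)) y"
    using c i by (auto simp: N_def)
  then show ?case by blast
qed

text \<open>The degrees within \<open>S\<close> sum to at most twice the number of pairs inside \<open>S\<close>, so the average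
  degree is at most \<open>2 * d\<close> and some vertex lies at or below the average.\<close>

lemma sparse_colouring:
  fixes A :: "('a \<times> 'a) set"
  assumes "finite V" "irrefl A"
    and sparse: "\<And>S. S \<subseteq> V \<Longrightarrow> card (A \<inter> S \<times> S) \<le> d * card S"
  shows "\<exists>c. c ` V \<subseteq> {..<2 * d + 1} \<and> (\<forall>x\<in>V. \<forall>y\<in>V. (x, y) \<in> A \<longrightarrow> c x \<noteq> c y)"
proof (rule greedy_colouring[OF assms(1,2)])
  fix S assume S: "S \<subseteq> V" "S \<noteq> {}"
  then have fin: "finite S" using \<open>finite V\<close> finite_subset by blast
  let ?out = "\<lambda>v. {w \<in> S. (v, w) \<in> A}" and ?in = "\<lambda>v. {w \<in> S. (w, v) \<in> A}"
  let ?nb = "\<lambda>v. {w \<in> S. (v, w) \<in> A \<or> (w, v) \<in> A}"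
  show "\<exists>v\<in>S. card (?nb v) < 2 * d + 1"
  proof (rule ccontr)
    assume "\<not> ?thesis"
    then have "\<And>v. v \<in> S \<Longrightarrow> 2 * d + 1 \<le> card (?nb v)" by force
    then have "card S * (2 * d + 1) \<le> (\<Sum>v\<in>S. card (?nb v))"
      using sum_bounded_below[of S "2 * d + 1" "\<lambda>v. card (?nb v)"] by simp
    also have "\<dots> \<le> (\<Sum>v\<in>S. card (?out v) + card (?in v))"
    proof (rule sum_mono)
      fix v
      have "?nb v = ?out v \<union> ?in v" by auto
      then show "card (?nb v) \<le> card (?out v) + card (?in v)" by (simp add: card_Un_le)
    qed
    also have "\<dots> = card (Sigma S ?out) + card (Sigma S ?in)"
      using fin by (simp add: sum.distrib card_SigmaI)
    also have "Sigma S ?out = A \<inter> S \<times> S" by auto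
    also have "Sigma S ?in = prod.swap ` (A \<inter> S \<times> S)" by force
    also have "card (prod.swap ` (A \<inter> S \<times> S)) = card (A \<inter> S \<times> S)"
      by (rule card_image) (auto intro: inj_onI)
    also have "card (A \<inter> S \<times> S) + card (A \<inter> S \<times> S) \<le> 2 * (d * card S)"
      using sparse[OF S(1)] by simp
    finally show False using fin S(2) by (simp add: algebra_simps)
  qed
qed

text \<open>Pairs of a relation of out-degree at most one are determined by their first component, and
  dually for in-degree, so both relations together have at most two pairs per vertex.\<close>

lemma single_valued_Un_converse_colouring:
  fixes A B :: "('a \<times> 'a) set"
  assumes "finite V" "irrefl (A \<union> B)" "single_valued A" "single_valued (B\<inverse>)"
  shows "\<exists>c. c ` V \<subseteq> {..<5::nat} \<and> (\<forall>x\<in>V. \<forall>y\<in>V. (x, y) \<in> A \<union> B \<longrightarrow> c x \<noteq> c y)"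
proof -
  have "card ((A \<union> B) \<inter> S \<times> S) \<le> 2 * card S" if "S \<subseteq> V" for S
  proof -
    have fin: "finite S" using that \<open>finite V\<close> finite_subset by blast
    have "card (A \<inter> S \<times> S) \<le> card S"
      by (rule card_inj_on_le[of fst]) (use assms(3) fin in \<open>auto simp: inj_on_def single_valued_def\<close>)
    moreover have "card (B \<inter> S \<times> S) \<le> card S"
      by (rule card_inj_on_le[of snd]) (use assms(4) fin in \<open>auto simp: inj_on_def single_valued_def\<close>)
    moreover have "(A \<union> B) \<inter> S \<times> S = (A \<inter> S \<times> S) \<union> (B \<inter> S \<times> S)" by auto
    ultimately show ?thesis
      using card_Un_le[of "A \<inter> S \<times> S" "B \<inter> S \<times> S"] by simp
  qed
  then show ?thesis
    using sparse_colouring[OF assms(1,2), of 2] by simp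
qed

section \<open>Recognising subdivisions of the antidirected four-cycle\<close>

text \<open>The sources of the subdivided cycle are \<open>w\<close> and \<open>x\<close>, its sinks are \<open>b\<close> and \<open>d\<close>. Two of
  the four subdivided arcs may stay single arcs in every application below, so only
  \<open>p\<close> and \<open>q\<close> have inner vertices that must be kept apart from the rest.\<close>

lemma (in digraph) contains_subdivision_hat_C4I:
  assumes xb: "(x, b) \<in> arcs_ends G" and xd: "(x, d) \<in> arcs_ends G"
    and p: "apath w p b" and q: "apath w q d"
    and pq: "set (awalk_verts w p) \<inter> set (awalk_verts w q) \<subseteq> {w}"
    and x: "x \<notin> set (awalk_verts w p) \<union> set (awalk_verts w q)"
    and ne: "b \<noteq> w" "d \<noteq> w"
  shows "contains_subdivision G (with_proj hat_C4)"
proof -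
  obtain e where e: "e \<in> arcs G" "tail G e = x" "head G e = b" using xb by (rule reachableE)
  obtain f where f: "f \<in> arcs G" "tail G f = x" "head G f = d" using xd by (rule reachableE)
  define H where "H = \<lparr> verts = set (awalk_verts w p) \<union> set (awalk_verts w q) \<union> {x},
    arcs = set p \<union> set q \<union> {e, f}, tail = tail G, head = head G \<rparr>"
  have H: "verts H = set (awalk_verts w p) \<union> set (awalk_verts w q) \<union> {x}"
    "arcs H = set p \<union> set q \<union> {e, f}" "tail H = tail G" "head H = head G"
    by (simp_all add: H_def)
  have aw: "awalk w p b" "awalk w q d" using p q by (auto simp: apath_def)
  have ends: "w \<in> set (awalk_verts w p)" "b \<in> set (awalk_verts w p)"
    "w \<in> set (awalk_verts w q)" "d \<in> set (awalk_verts w q)"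
    using aw hd_in_awalk_verts by auto
  have sub: "set p \<subseteq> arcs G" "set q \<subseteq> arcs G" using aw by (auto simp: awalk_def)
  have inv: "set (awalk_verts w p) \<subseteq> verts G" "set (awalk_verts w q) \<subseteq> verts G"
    using aw awalk_conv by blast+
  have hv: "tail G a \<in> verts H \<and> head G a \<in> verts H" if "a \<in> arcs H" for a
  proof -
    have "a \<in> set p \<or> a \<in> set q \<or> a = e \<or> a = f" using that by (auto simp: H)
    then show ?thesis
      using awalk_verts_arc1[of a p w] awalk_verts_arc1[of a q w]
        awalk_verts_arc2[OF aw(1)] awalk_verts_arc2[OF aw(2)] ends e f unfolding H by blast
  qed
  have "x \<in> verts G" using e by auto
  have comp: "compatible G H" by (simp add: compatible_def H)
  have arcs_sub: "arcs H \<subseteq> arcs G" using sub e f by (simp add: H)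
  interpret H: digraph H
  proof
    fix a assume a: "a \<in> arcs H"
    show "tail H a \<in> verts H" "head H a \<in> verts H"
      using hv[OF a] by (simp_all add: H(3,4))
    show "tail H a \<noteq> head H a" using no_loops a arcs_sub H(3,4) by auto
  next
    show "finite (verts H)" "finite (arcs H)" by (simp_all add: H(1,2))
  next
    fix a a' assume "a \<in> arcs H" "a' \<in> arcs H" "arc_to_ends H a = arc_to_ends H a'"
    then show "a = a'"
      using no_multi_arcs[of a a'] arcs_sub by (auto simp: arc_to_ends_def H(3,4))
  qed
  have "subgraph H G"
    unfolding subgraph_def using arcs_sub inv comp \<open>x \<in> verts G\<close> H.wf_digraph wf_digraph
    by (simp add: H(1))
  have vH: "H.awalk_verts = awalk_verts" and casH: "H.cas = cas"
    using compatible_awalk_verts[OF comp] compatible_cas[OF comp] by auto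
  have pH: "H.apath w p b" "H.apath w q d"
    using p q ends unfolding H.apath_def H.awalk_def apath_def awalk_def vH casH H(1,2) by blast+
  have eH: "H.apath x [e] b" "H.apath x [f] d"
    using e f ends x no_loops[of e] no_loops[of f]
    by (simp_all add: H.apath_simps H)
  have innH: "set (H.inner_verts p) = set (awalk_verts w p) - {w, b}"
    "set (H.inner_verts q) = set (awalk_verts w q) - {w, d}"
    using H.set_inner_verts[OF pH(1)] H.set_inner_verts[OF pH(2)] unfolding vH .
  have neqs: "b \<noteq> d" "x \<noteq> w" "x \<noteq> b" "x \<noteq> d" using ends pq ne x by auto
  \<comment> \<open>In \<^const>\<open>hat_C4\<close> the sources are \<open>0\<close> and \<open>2\<close>, the sinks \<open>1\<close> and \<open>3\<close>.\<close>
  define g :: "nat \<Rightarrow> 'a" where "g = (\<lambda>i. if i = 0 then w else if i = 1 then b else if i = 2 then x else d)"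
  define P where "P = (\<lambda>a :: nat \<times> nat. if a = (0,1) then p else if a = (2,1) then [e]
     else if a = (2,3) then [f] else q)"
  have "p \<noteq> []" "q \<noteq> []" using ne aw by (auto simp: awalk_Nil_iff)
  have "directed_subdivision (with_proj hat_C4) H"
    unfolding directed_subdivision_def
  proof (intro conjI exI[of _ g] exI[of _ P] digraph_hat_C4)
    show "digraph H" ..
    show "inj_on g (verts (with_proj hat_C4))"
      using neqs ne by (auto simp: g_def hat_C4_def)
    show "\<forall>a\<in>arcs (with_proj hat_C4). P a \<noteq> [] \<and>
        H.apath (g (tail (with_proj hat_C4) a)) (P a) (g (head (with_proj hat_C4) a))"
      using pH eH \<open>p \<noteq> []\<close> \<open>q \<noteq> []\<close> by (auto simp: g_def P_def hat_C4_def)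
    show "\<forall>a\<in>arcs (with_proj hat_C4). set (H.inner_verts (P a)) \<inter> g ` verts (with_proj hat_C4) = {}"
      using innH ends x pq by (auto simp: g_def P_def hat_C4_def)
    show "\<forall>a\<in>arcs (with_proj hat_C4). \<forall>b\<in>arcs (with_proj hat_C4). a \<noteq> b \<longrightarrow>
        set (H.inner_verts (P a)) \<inter> set (H.inner_verts (P b)) = {}"
      using innH pq by (auto simp: P_def hat_C4_def)
    show "verts H = g ` verts (with_proj hat_C4) \<union>
        (\<Union>a\<in>arcs (with_proj hat_C4). set (H.inner_verts (P a)))"
      using innH ends by (auto simp: P_def g_def hat_C4_def H)
    show "arcs H = (\<Union>a\<in>arcs (with_proj hat_C4). set (P a))"
      by (auto simp: P_def hat_C4_def H)
  qed
  with \<open>subgraph H G\<close> show ?thesis by (auto simp: contains_subdivision_def)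
qed

section \<open>Breadth-first search trees\<close>

locale generated_digraph = digraph +
  fixes root
  assumes out_generator: "out_generator G root"
begin

definition level :: "'a \<Rightarrow> nat" where
  "level x = (LEAST n. (root, x) \<in> arcs_ends G ^^ n)"

lemma awalk_imp_relpow: "awalk x p y \<Longrightarrow> (x, y) \<in> arcs_ends G ^^ length p"
proof (induction p arbitrary: x)
  case Nil
  then show ?case by (simp add: awalk_Nil_iff)
next
  case (Cons e p)
  then have e: "e \<in> arcs G" "tail G e = x" and p: "awalk (head G e) p y"
    by (simp_all add: awalk_Cons_iff)
  then have "(x, head G e) \<in> arcs_ends G" unfolding arcs_ends_conv by blast
  then show ?case unfolding list.size(4) add_Suc_right add_0_right
    using Cons.IH[OF p] by (rule relpow_Suc_I2)
qed

lemma relpow_level: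
  assumes "x \<in> verts G" shows "(root, x) \<in> arcs_ends G ^^ level x"
proof -
  obtain p where "apath root p x" using assms out_generator by (auto simp: out_generator_def)
  then have "(root, x) \<in> arcs_ends G ^^ length p" using awalk_imp_relpow by (auto simp: apath_def)
  then show ?thesis unfolding level_def by (rule LeastI)
qed

lemma level_le: "(root, x) \<in> arcs_ends G ^^ n \<Longrightarrow> level x \<le> n"
  unfolding level_def by (rule Least_le)

lemma level_arc_le:
  assumes "(x, y) \<in> arcs_ends G" shows "level y \<le> Suc (level x)"
  by (rule level_le[OF relpow_Suc_I[OF relpow_level[OF adj_in_verts(1)[OF assms]] assms]])

lemma parent_exists:
  assumes "x \<in> verts G" "x \<noteq> root"
  shows "\<exists>z. (z, x) \<in> arcs_ends G \<and> level x = Suc (level z)"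
proof (cases "level x")
  case 0
  then show ?thesis using relpow_level[OF assms(1)] assms(2) by simp
next
  case (Suc n)
  then obtain z where z: "(root, z) \<in> arcs_ends G ^^ n" "(z, x) \<in> arcs_ends G"
    using relpow_level[OF assms(1)] relpow_Suc_E[of root x n "arcs_ends G"] by metis
  then have "level x = Suc (level z)"
    using level_le[OF z(1)] level_arc_le[OF z(2)] Suc by simp
  then show ?thesis using z by blast
qed

definition parent :: "'a \<Rightarrow> 'a" where
  "parent x = (SOME z. (z, x) \<in> arcs_ends G \<and> level x = Suc (level z))"

lemma parent:
  assumes "x \<in> verts G" "x \<noteq> root"
  shows "(parent x, x) \<in> arcs_ends G" "level x = Suc (level (parent x))"
  using someI_ex[OF parent_exists[OF assms]] by (auto simp: parent_def)

definition tree :: "('a \<times> 'a) set" where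
  "tree = {(parent x, x) | x. x \<in> verts G - {root}}"

lemma tree_arc:
  assumes "(x, y) \<in> tree"
  shows "(x, y) \<in> arcs_ends G" "level y = Suc (level x)"
  using assms parent unfolding tree_def by blast+

text \<open>Every use of disjointness below is a comparison of levels through this fact: a tree path avoids
  any vertex whose level is at least that of the end of the path, except the end itself.\<close>

lemma tree_level: "(x, y) \<in> tree\<^sup>* \<Longrightarrow> x = y \<or> level x < level y"
  by (induction rule: rtrancl_induct) (auto dest: tree_arc(2))

lemma tree_verts: "(x, y) \<in> tree\<^sup>* \<Longrightarrow> y \<in> verts G \<Longrightarrow> x \<in> verts G"
  by (induction rule: converse_rtrancl_induct) (simp, blast dest: tree_arc(1) adj_in_verts(1))

lemma root_ancestor: "x \<in> verts G \<Longrightarrow> (root, x) \<in> tree\<^sup>*"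
proof (induction "level x" arbitrary: x rule: less_induct)
  case less
  show ?case
  proof (cases "x = root")
    case False
    then have "(parent x, x) \<in> tree" using less.prems by (auto simp: tree_def)
    moreover have "parent x \<in> verts G" "level (parent x) < level x"
      using adj_in_verts(1)[OF parent(1)[OF less.prems False]] parent(2)[OF less.prems False] by simp_all
    ultimately show ?thesis using less.hyps by (meson rtrancl.rtrancl_into_rtrancl)
  qed simp
qed

text \<open>Climbing from \<open>y\<close> is deterministic, so the ancestors of \<open>y\<close> form a chain.\<close>

lemma ancestors_comparable:
  assumes "(a, y) \<in> tree\<^sup>*" "(b, y) \<in> tree\<^sup>*"
  shows "(a, b) \<in> tree\<^sup>* \<or> (b, a) \<in> tree\<^sup>*"
proof -
  have "single_valued (tree\<inverse>)" by (auto simp: single_valued_def tree_def)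
  then show ?thesis
    using single_valued_confluent[of "tree\<inverse>" y a b] assms by (auto simp: rtrancl_converse)
qed

lemma tree_path:
  assumes "(w, y) \<in> tree\<^sup>*" "y \<in> verts G"
  shows "\<exists>p. apath w p y \<and> (\<forall>v\<in>set (awalk_verts w p). (w, v) \<in> tree\<^sup>* \<and> (v, y) \<in> tree\<^sup>*)"
  using assms
proof (induction rule: converse_rtrancl_induct)
  case base
  then show ?case by (intro exI[of _ "[]"]) (auto simp: apath_Nil_iff)
next
  case (step w z)
  then obtain p where p: "apath z p y"
      "\<forall>v\<in>set (awalk_verts z p). (z, v) \<in> tree\<^sup>* \<and> (v, y) \<in> tree\<^sup>*" by blast
  obtain e where e: "e \<in> arcs G" "tail G e = w" "head G e = z"
    using tree_arc(1)[OF step.hyps(1)] by (rule reachableE)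
  have "w \<notin> set (awalk_verts z p)"
    using p(2) tree_level[of z w] tree_arc(2)[OF step.hyps(1)] by auto
  then have "apath w (e # p) y" using p e by (simp add: apath_Cons_iff)
  moreover have "\<forall>v\<in>set (awalk_verts w (e # p)). (w, v) \<in> tree\<^sup>* \<and> (v, y) \<in> tree\<^sup>*"
    using p(2) e step.hyps by (auto intro: converse_rtrancl_into_rtrancl)
  ultimately show ?case by blast
qed

text \<open>The common ancestor of greatest level works. The minimality is phrased so that it says
  directly that the tree paths from \<open>w\<close> to \<open>y\<close> and to \<open>z\<close> meet only in \<open>w\<close>.\<close>

lemma lowest_common_ancestor:
  assumes "y \<in> verts G" "z \<in> verts G"
  shows "\<exists>w. (w, y) \<in> tree\<^sup>* \<and> (w, z) \<in> tree\<^sup>* \<and>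
    (\<forall>v. (w, v) \<in> tree\<^sup>* \<and> (v, y) \<in> tree\<^sup>* \<and> (v, z) \<in> tree\<^sup>* \<longrightarrow> v = w)"
proof -
  let ?C = "{v. (v, y) \<in> tree\<^sup>* \<and> (v, z) \<in> tree\<^sup>*}"
  have "\<forall>v. v \<in> ?C \<longrightarrow> level v < Suc (level y)" using tree_level by fastforce
  moreover have "root \<in> ?C" using root_ancestor assms by blast
  ultimately obtain w where w: "w \<in> ?C" "\<And>v. v \<in> ?C \<Longrightarrow> level v \<le> level w"
    using ex_has_greatest_nat[of "\<lambda>v. v \<in> ?C" root level "Suc (level y)"] by blast
  have "v = w" if "(w, v) \<in> tree\<^sup>*" "v \<in> ?C" for v
    using tree_level[OF that(1)] w(2)[OF that(2)] by auto
  with w(1) show ?thesis by blast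
qed

section \<open>Arcs that do not descend in the tree\<close>

definition nondescending :: "('a \<times> 'a) set" where
  "nondescending = {(x, y) \<in> arcs_ends G. level y \<le> level x}"

definition top :: "'a \<Rightarrow> 'a" where
  "top x = arg_min level (\<lambda>y. (x, y) \<in> nondescending)"

lemma irrefl_nondescending: "irrefl nondescending"
  using adj_not_same by (auto simp: irrefl_def nondescending_def)

lemma top:
  assumes "(x, y) \<in> nondescending"
  shows "(x, top x) \<in> nondescending" "level (top x) \<le> level y"
  using arg_min_nat_lemma[of "\<lambda>y. (x, y) \<in> nondescending" y level] assms
  by (auto simp: top_def)

context
  assumes no_subdivision: "\<not> contains_subdivision G (with_proj hat_C4)"
begin

text \<open>For incomparable heads \<open>y\<close> and \<open>z\<close>, their lowest common ancestor differs from both and is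
  the second source of a subdivided \<^const>\<open>hat_C4\<close>. The level of \<open>x\<close> is too large for
  \<open>x\<close> to lie on the two tree paths.\<close>

lemma nondescending_heads_comparable:
  assumes y: "(x, y) \<in> nondescending" and z: "(x, z) \<in> nondescending"
  shows "(y, z) \<in> tree\<^sup>* \<or> (z, y) \<in> tree\<^sup>*"
proof (rule ccontr)
  assume incomparable: "\<not> ?thesis"
  have arcs: "(x, y) \<in> arcs_ends G" "(x, z) \<in> arcs_ends G"
    and le: "level y \<le> level x" "level z \<le> level x"
    using y z by (auto simp: nondescending_def)
  have verts: "y \<in> verts G" "z \<in> verts G" using arcs by (blast dest: adj_in_verts(2))+
  obtain w where w: "(w, y) \<in> tree\<^sup>*" "(w, z) \<in> tree\<^sup>*"
      "\<And>v. (w, v) \<in> tree\<^sup>* \<Longrightarrow> (v, y) \<in> tree\<^sup>* \<Longrightarrow> (v, z) \<in> tree\<^sup>* \<Longrightarrow> v = w"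
    using lowest_common_ancestor[OF verts] by blast
  obtain p where p: "apath w p y"
      "\<And>v. v \<in> set (awalk_verts w p) \<Longrightarrow> (w, v) \<in> tree\<^sup>* \<and> (v, y) \<in> tree\<^sup>*"
    using tree_path[OF w(1) verts(1)] by blast
  obtain q where q: "apath w q z"
      "\<And>v. v \<in> set (awalk_verts w q) \<Longrightarrow> (w, v) \<in> tree\<^sup>* \<and> (v, z) \<in> tree\<^sup>*"
    using tree_path[OF w(2) verts(2)] by blast
  have "x \<noteq> y" "x \<noteq> z" using arcs adj_not_same by blast+
  then have "(x, y) \<notin> tree\<^sup>*" "(x, z) \<notin> tree\<^sup>*" using tree_level le by fastforce+
  then have "x \<notin> set (awalk_verts w p) \<union> set (awalk_verts w q)" using p(2) q(2) by blast
  moreover have "set (awalk_verts w p) \<inter> set (awalk_verts w q) \<subseteq> {w}"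
    using p(2) q(2) w(3) by blast
  moreover have "y \<noteq> w" "z \<noteq> w" using incomparable w by auto
  ultimately show False
    using contains_subdivision_hat_C4I[OF arcs p(1) q(1)] no_subdivision by blast
qed

lemma top_strict_ancestor:
  assumes "(x, y) \<in> nondescending" "y \<noteq> top x"
  shows "(top x, y) \<in> tree\<^sup>*" "level (top x) < level y"
proof -
  have "(top x, y) \<in> tree\<^sup>* \<or> (y, top x) \<in> tree\<^sup>*"
    using nondescending_heads_comparable top(1) assms(1) by blast
  then show "(top x, y) \<in> tree\<^sup>*" "level (top x) < level y"
    using tree_level top(2)[OF assms(1)] assms(2) by fastforce+
qed

text \<open>Here the sources are \<open>x\<close> and \<open>z\<close> and the sinks \<open>y\<close> and \<open>top z\<close>; the tree path from
  \<open>top x\<close> to \<open>top z\<close>, which may be trivial, completes the arc \<open>x \<rightarrow> top x\<close>. All its levels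
  are less than that of \<open>y\<close>, hence it misses \<open>x\<close>, \<open>y\<close> and \<open>z\<close>.\<close>

lemma tops_incomparable:
  assumes y: "(x, y) \<in> nondescending" "(z, y) \<in> nondescending"
    and ne: "y \<noteq> top x" "y \<noteq> top z" "x \<noteq> z"
  shows "(top x, top z) \<notin> tree\<^sup>*"
proof
  assume xz: "(top x, top z) \<in> tree\<^sup>*"
  have arcs: "(z, y) \<in> arcs_ends G" "(z, top z) \<in> arcs_ends G"
    "(x, y) \<in> arcs_ends G" "(x, top x) \<in> arcs_ends G"
    using y top(1) by (auto simp: nondescending_def)
  have lv: "level (top z) < level y" "level y \<le> level x" "level y \<le> level z"
    using top_strict_ancestor(2) y ne by (auto simp: nondescending_def)
  have "top z \<in> verts G" using arcs(2) by (rule adj_in_verts(2))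
  then obtain p where p: "apath (top x) p (top z)"
      "\<And>v. v \<in> set (awalk_verts (top x) p) \<Longrightarrow> (v, top z) \<in> tree\<^sup>*"
    using tree_path[OF xz] by blast
  have low: "level v < level y" if "v \<in> set (awalk_verts (top x) p)" for v
    using p(2)[OF that] tree_level lv(1) by fastforce
  obtain e where e: "e \<in> arcs G" "tail G e = x" "head G e = y" using arcs(3) by (rule reachableE)
  obtain f where f: "f \<in> arcs G" "tail G f = x" "head G f = top x" using arcs(4) by (rule reachableE)
  have xy: "x \<noteq> y" "z \<noteq> y" using arcs adj_not_same by blast+
  have out: "x \<notin> set (awalk_verts (top x) p)" "z \<notin> set (awalk_verts (top x) p)"
    "y \<notin> set (awalk_verts (top x) p)"
    using low lv by fastforce+
  have "apath x [e] y" using e xy by (auto simp: apath_simps)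
  moreover have "apath x (f # p) (top z)" using f p(1) out(1) by (simp add: apath_Cons_iff)
  moreover have "set (awalk_verts x [e]) \<inter> set (awalk_verts x (f # p)) \<subseteq> {x}"
    using e f out(3) by auto
  moreover have "z \<notin> set (awalk_verts x [e]) \<union> set (awalk_verts x (f # p))"
    using e f out(2) xy ne(3) by auto
  moreover have "top z \<noteq> x" using lv by auto
  ultimately show False
    using contains_subdivision_hat_C4I[OF arcs(1,2)] xy(1) no_subdivision by blast
qed

text \<open>Two arcs entering \<open>y\<close> that both avoid the topmost heads would make these heads
  ancestors of \<open>y\<close>, hence comparable, which is the situation just excluded.\<close>

lemma nondescending_colouring:
  "\<exists>c. c ` verts G \<subseteq> {..<5::nat} \<and> (\<forall>(x, y)\<in>nondescending. c x \<noteq> c y)"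
proof -
  let ?A = "{(x, y) \<in> nondescending. y = top x}" and ?B = "{(x, y) \<in> nondescending. y \<noteq> top x}"
  have "single_valued (?B\<inverse>)"
  proof (rule single_valuedI)
    fix y x z assume "(y, x) \<in> ?B\<inverse>" "(y, z) \<in> ?B\<inverse>"
    then have *: "(x, y) \<in> nondescending" "(z, y) \<in> nondescending" "y \<noteq> top x" "y \<noteq> top z" by auto
    then have "(top x, top z) \<in> tree\<^sup>* \<or> (top z, top x) \<in> tree\<^sup>*"
      using ancestors_comparable top_strict_ancestor(1) by blast
    then show "x = z" using * tops_incomparable by metis
  qed
  moreover have "single_valued ?A" by (auto simp: single_valued_def)
  moreover have AB: "?A \<union> ?B = nondescending" by auto
  ultimately obtain c where "c ` verts G \<subseteq> {..<5::nat}"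
      "\<forall>x\<in>verts G. \<forall>y\<in>verts G. (x, y) \<in> nondescending \<longrightarrow> c x \<noteq> c y"
    using single_valued_Un_converse_colouring[OF finite_verts, of ?A ?B] irrefl_nondescending
    by auto
  moreover have "x \<in> verts G \<and> y \<in> verts G" if "(x, y) \<in> nondescending" for x y
    using that adj_in_verts[of x y] by (simp add: nondescending_def)
  ultimately show ?thesis by (intro exI[of _ c]) auto
qed

lemma colouring:
  "\<exists>c. c ` verts G \<subseteq> {..<10::nat} \<and> (\<forall>(x, y)\<in>arcs_ends G. c x \<noteq> c y)"
proof -
  obtain c where c: "c ` verts G \<subseteq> {..<5::nat}" "\<forall>(x, y)\<in>nondescending. c x \<noteq> c y"
    using nondescending_colouring by blast
  \<comment> \<open>This encodes the pair of the colour \<open>c x\<close> and the parity of the level.\<close>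
  define c' where "c' x = 2 * c x + level x mod 2" for x
  have "c' x \<noteq> c' y" if xy: "(x, y) \<in> arcs_ends G" for x y
  proof (cases "level y \<le> level x")
    case True
    then have "c x \<noteq> c y" using c(2) xy by (auto simp: nondescending_def)
    then show ?thesis unfolding c'_def by presburger
  next
    case False
    then have "level y = Suc (level x)" using level_arc_le[OF xy] by simp
    then show ?thesis unfolding c'_def by presburger
  qed
  moreover have "c' x < 10" if "x \<in> verts G" for x
  proof -
    have "c x < 5" using c(1) that by auto
    then show ?thesis unfolding c'_def by presburger
  qed
  ultimately show ?thesis by (intro exI[of _ c']) auto
qed

end

end

section \<open>The chromatic bound\<close>

theorem theorem43:
  fixes D :: "('a,'b) pre_digraph"
  assumes "digraph D"
    and "\<not> contains_subdivision D (with_proj hat_C4)"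
    and "\<exists>u. out_generator D u"
  shows "chromatic_number D \<le> 24"
proof -
  obtain u where u: "out_generator D u" using assms(3) by blast
  interpret generated_digraph D u
    using assms(1) u by (simp add: generated_digraph_def generated_digraph_axioms_def)
  obtain c where c: "c ` verts D \<subseteq> {..<10::nat}" "\<forall>(x, y)\<in>arcs_ends D. c x \<noteq> c y"
    using colouring[OF assms(2)] by blast
  have "k_colourable (with_proj (mk_symmetric D)) 10"
    unfolding k_colourable_def
  proof (intro exI[of _ c] conjI)
    show "c \<in> verts (with_proj (mk_symmetric D)) \<rightarrow> {..<10}" using c(1) by auto
    show "\<forall>(x, y)\<in>arcs_ends (with_proj (mk_symmetric D)). c x \<noteq> c y"
      using c(2) by (fastforce simp: parcs_mk_symmetric arcs_ends_conv)
  qed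
  then have "chromatic_number D \<le> 10"
    unfolding chromatic_number_def by (rule Least_le)
  then show ?thesis by simp
qed

end
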